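(* For any non-negative integer $k$ and every integer $n\ge 0$, the following congruences hold: \begin{itemize} \item[(i)] $p_{5k+1}(5n+4)\equiv 0 \pmod 5$. \item[(ii)] $p_{5k+2}(5n+i)\equiv 0 \pmod 5$ for $i=2,3,4$. \item[(iii)] $p_{5k+4}(5n+i)\equiv 0 \pmod 5$ for $i=3,4$. \item[(iv)] $p_{25k+3}(25n+22)\equiv 0 \pmod 5$. \item[(v)] $p_{25k+4}(25n+21)\equiv 0 \pmod 5$. \end{itemize}
   Context: For a positive integer $r$, $p_r(n)$ denotes the number of $r$-colour partitions of $n$, i.e. the number of partitions of $n$ in which each part is available in $r$ distinct colours (there are $r$ copies of each part size, all viewed as distinct objects; the order of parts is irrelevant). Equivalently, $p_r(n)$ is defined by the generating function $$\sum_{n=0}^{\infty}p_r(n)q^n=\frac{1}{(q;q)_\infty^{r}},\qquad (a;q)_\infty=\prod_{n=0}^{\infty}(1-aq^n),$$ so that $p_r(0)=1$. *)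

theory Defs
  imports
    "HOL-Library.Multiset"
    "HOL-Number_Theory.Cong"
    "HOL-Computational_Algebra.Computational_Algebra"
begin

text \<open>
  An \<open>r\<close>-colour partition of \<open>n\<close> is a finite multiset of coloured parts \<open>(m, c)\<close>, with size
  \<open>m > 0\<close> and colour \<open>c < r\<close>, whose sizes add up to \<open>n\<close> (with multiplicity). Two parts of equal
  size but different colour are distinct, and the multiset disregards the order of the parts.
\<close>

definition colour_partitions :: "nat \<Rightarrow> nat \<Rightarrow> (nat \<times> nat) multiset set" where
  "colour_partitions r n =
     {P. (\<forall>(m, c) \<in># P. m > 0 \<and> c < r) \<and> (\<Sum>(m, c) \<in># P. m) = n}"

definition num_colour_partitions :: "nat \<Rightarrow> nat \<Rightarrow> nat" where
  "num_colour_partitions r n = card (colour_partitions r n)"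

text \<open>
  There are only finitely many \<open>r\<close>-colour partitions of \<open>n\<close>, so the cardinality above is a genuine
  count.
\<close>

lemma finite_colour_partitions: "finite (colour_partitions r n)"
proof -
  let ?A = "{1..n} \<times> {..<r}"
  have "colour_partitions r n \<subseteq> mset ` {xs. set xs \<subseteq> ?A \<and> length xs \<le> n}"
  proof
    fix P assume "P \<in> colour_partitions r n"
    then have parts: "\<And>m c. (m, c) \<in># P \<Longrightarrow> m > 0 \<and> c < r"
      and total: "(\<Sum>x \<in># P. fst x) = n"
      by (auto simp: colour_partitions_def case_prod_unfold)
    have le: "fst x \<le> n" if "x \<in># P" for x
      using that total by (metis image_mset_add_mset insert_DiffM le_add1 sum_mset.add_mset)
    have "size P = (\<Sum>x \<in># P. 1)" by simp
    also have "\<dots> \<le> (\<Sum>x \<in># P. fst x)"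
      by (rule sum_mset_mono) (use parts in \<open>force simp: Suc_le_eq\<close>)
    finally have sz: "size P \<le> n" using total by simp
    obtain xs where xs: "mset xs = P" using ex_mset by blast
    have "set xs \<subseteq> ?A" using parts le xs by (fastforce simp: Suc_le_eq)
    moreover have "length xs \<le> n" using sz xs by auto
    ultimately show "P \<in> mset ` {xs. set xs \<subseteq> ?A \<and> length xs \<le> n}" using xs by auto
  qed
  then show ?thesis
    by (rule finite_subset) (simp add: finite_lists_length_le)
qed

lemma num_colour_partitions_0: "num_colour_partitions r 0 = 1"
proof -
  have "P = {#}" if "P \<in> colour_partitions r 0" for P
  proof (rule ccontr)
    assume "P \<noteq> {#}"
    then obtain x where "x \<in># P" by (meson multiset_nonemptyE)
    with that show False by (force simp: colour_partitions_def case_prod_unfold)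
  qed
  moreover have "{#} \<in> colour_partitions r 0" by (simp add: colour_partitions_def)
  ultimately have "colour_partitions r 0 = {{#}}" by blast
  then show ?thesis by (simp add: num_colour_partitions_def)
qed

end

theory Submission
  imports Defs
begin

text \<open>
  Let \<open>E = (q; q)\<^sub>\<infinity>\<close>, so that the generating function of \<open>p\<^sub>r\<close> is \<open>E\<^bsup>-r\<^esup>\<close>
  (\<open>partition_gf_times_euler_power\<close>). Modulo 5 one has \<open>E(q)\<^sup>5 \<equiv> E(q\<^sup>5)\<close>, so for \<open>s \<le> 5\<close>
  the generating function of \<open>p\<^bsub>5k+s\<^esub>\<close> is congruent to a power series in \<open>q\<^sup>5\<close> times
  \<open>E\<^bsup>5-s\<^esup>\<close> (\<open>partition_gf_cong\<close>). A factor that is a series in \<open>q\<^sup>5\<close> does not affect which residue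
  classes of exponents mod 5 can carry a coefficient prime to 5, so everything depends on the exponents that
  occur in \<open>E\<close>, \<open>E\<^sup>2\<close>, \<open>E\<^sup>3\<close> and \<open>E\<^sup>4\<close>.

  Two classical expansions supply them. By Euler, the exponents in \<open>E\<close> are the generalised pentagonal
  numbers, which are 0, 1 or 2 mod 5. By Jacobi, \<open>E\<^sup>3 = \<Sum> (-1)\<^sup>m (2m+1) q\<^bsup>m(m+1)/2\<^esup>\<close>, where the exponents are
  0, 1 or 3 mod 5 and the class 3 occurs only with \<open>5 dvd 2m+1\<close>; modulo 5 only the classes 0 and 1 remain.
  Hence \<open>E\<^sup>4 = E\<^sup>3 E\<close> misses the class 4 modulo 5. The cases \<open>s = 1, 2, 4\<close>, that is \<open>E\<^sup>4\<close>, \<open>E\<^sup>3\<close> and \<open>E\<close>,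
  are parts (i), (ii) and (iii).

  For the last two parts write \<open>25k + s = 5(5k) + s\<close>. The series in \<open>q\<^sup>5\<close> is then obtained from the generating
  function \<open>H\<close> of \<open>p\<^bsub>5k+1\<^esub>\<close>, which misses the class 4 modulo 5 by (i), and
  the problem is to extract one residue class of exponents from \<open>H(q\<^sup>5) E\<^bsup>5-s\<^esup>\<close>. Dissect
  \<open>E = G\<^sub>0 + G\<^sub>1 + G\<^sub>2\<close> according to exponents mod 5. The generalised pentagonal numbers that are 1 mod 5 are the numbers
  \<open>25g + 1\<close> with \<open>g\<close> pentagonal again, which gives \<open>G\<^sub>1 = -q E(q\<^bsup>25\<^esup>)\<close>. Comparing terms with exponents in the class 2
  in \<open>E\<^sup>3 = (G\<^sub>0 + G\<^sub>1 + G\<^sub>2)\<^sup>3\<close> gives \<open>0 = 3 G\<^sub>0 (G\<^sub>0 G\<^sub>2 + G\<^sub>1\<^sup>2)\<close>, hence \<open>G\<^sub>0 G\<^sub>2 = -G\<^sub>1\<^sup>2\<close>, and so the part of \<open>E\<^sup>2\<close>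
  in the class 2 is \<open>G\<^sub>1\<^sup>2 + 2 G\<^sub>0 G\<^sub>2 = -q\<^sup>2 E(q\<^bsup>25\<^esup>)\<^sup>2\<close>. In both cases the extracted class is, up to sign and a
  shift, \<open>H(q) E(q\<^sup>5)\<^sup>j\<close> evaluated at \<open>q\<^sup>5\<close>, with \<open>j = 2\<close> or \<open>j = 1\<close>, and it inherits from \<open>H\<close> that the class 4
  is missing (\<open>expand_mult_dissected_nth\<close>). As \<open>25n + 22 = 5(5n + 4) + 2\<close> and \<open>25n + 21 = 5(5n + 4) + 1\<close>, this is
  parts (iv) and (v).

  Both classical expansions are obtained as limits of identities between polynomials, each proved by a
  telescoping sum, so that only finite products occur and \<open>E\<close> is handled through its truncations.
\<close>

section \<open>Finite products of the factors \<open>1 - q\<^sup>i\<close>\<close>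

definition qprod :: "'a::comm_ring_1 \<Rightarrow> nat \<Rightarrow> nat \<Rightarrow> 'a" where
  "qprod q a b = (\<Prod>i=a..b. 1 - q ^ i)"

lemma qprod_first: "a \<le> b \<Longrightarrow> qprod q a b = (1 - q ^ a) * qprod q (Suc a) b"
  by (simp add: qprod_def prod.atLeast_Suc_atMost)

lemma qprod_last: "a \<le> Suc b \<Longrightarrow> qprod q a (Suc b) = (1 - q ^ Suc b) * qprod q a b"
  by (simp add: qprod_def prod.nat_ivl_Suc' mult.commute)

lemma qprod_empty [simp]: "b < a \<Longrightarrow> qprod q a b = 1"
  by (simp add: qprod_def)

lemma qprod_0 [simp]: "qprod q 0 b = 0"
  by (simp add: qprod_first)

section \<open>A finite form of Euler's pentagonal number theorem\<close>

definition shanks_term :: "'a::comm_ring_1 \<Rightarrow> nat \<Rightarrow> nat \<Rightarrow> 'a" where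
  "shanks_term q n s = (-1) ^ s * qprod q (Suc s) n * q ^ (n * s + s * (s + 1) div 2)"

lemma triangular_Suc: "Suc s * (Suc s + 1) div 2 = s * (s + 1) div 2 + Suc s"
proof -
  have "Suc s * (Suc s + 1) = s * (s + 1) + Suc s * 2" by simp
  then show ?thesis by (metis div_mult_self3 zero_neq_numeral add.commute)
qed

text \<open>
  The summand of Shanks's identity changes by a telescoping difference when \<open>n\<close> grows by one. Here \<open>U s\<close> is
  the summand with the extra factor \<open>1 - q\<^sup>s\<close>, so that \<open>U 0 = 0\<close>.
\<close>
lemma shanks_term_step:
  fixes q :: "'a::comm_ring_1"
  assumes "s \<le> n"
  defines "U \<equiv> \<lambda>s. (-1) ^ s * qprod q s n * q ^ (n * s + s * (s + 1) div 2)"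
  shows "shanks_term q (Suc n) s - shanks_term q n s = U (Suc s) - U s"
proof -
  let ?C = "(-1) ^ s * qprod q (Suc s) n * q ^ (n * s + s * (s + 1) div 2)"
  have 1: "shanks_term q (Suc n) s = ?C * q ^ s * (1 - q ^ Suc n)"
    using assms(1) by (simp add: shanks_term_def qprod_last power_add mult_ac)
  have 2: "shanks_term q n s = ?C" by (simp add: shanks_term_def)
  have 3: "U s = ?C * (1 - q ^ s)"
    using assms(1) by (simp add: U_def qprod_first mult_ac)
  have "n * Suc s + Suc s * (Suc s + 1) div 2 = (n * s + s * (s + 1) div 2) + s + Suc n"
    by (simp only: triangular_Suc) simp
  then have 4: "U (Suc s) = - ?C * q ^ s * q ^ Suc n"
    unfolding U_def by (simp only: power_add) (simp add: mult_ac)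
  show ?thesis unfolding 1 2 3 4 by (simp add: algebra_simps)
qed

text \<open>
  The generalised pentagonal numbers. With \<open>j\<close> ranging over all integers, both forms
  \<open>j (3 j + 1) / 2\<close> and \<open>j (3 j - 1) / 2\<close> are covered.
\<close>
definition pent :: "int \<Rightarrow> nat" where
  "pent j = nat (j * (3 * j + 1) div 2)"

lemma pent_eqI: "j * (3 * j + 1) = 2 * int N \<Longrightarrow> pent j = N"
  by (simp add: pent_def)

text \<open>
  Shanks's identity. In the left-hand sum only the term \<open>s = 0\<close>, which is the product \<open>(q; q)\<^sub>n\<close>, has
  contributions below \<open>q\<^bsup>n+1\<^esup>\<close>. By telescoping, each step from \<open>n\<close> to \<open>n + 1\<close> adds exactly
  the two pentagonal terms with indices \<open>n + 1\<close> and \<open>-(n + 1)\<close>.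
\<close>
theorem shanks_identity:
  "(\<Sum>s\<le>n. shanks_term q n s) =
     (\<Sum>j\<in>{-int n..int n}. (-1) ^ nat \<bar>j\<bar> * q ^ pent j)"
proof (induction n)
  case 0
  show ?case by (simp add: shanks_term_def pent_def)
next
  case (Suc n)
  define U where "U = (\<lambda>s. (-1) ^ s * qprod q s n * q ^ (n * s + s * (s + 1) div 2))"
  let ?N = "Suc n"
  have "(\<Sum>s\<le>n. shanks_term q ?N s) - (\<Sum>s\<le>n. shanks_term q n s) =
      (\<Sum>s\<le>n. U (Suc s) - U s)"
    by (simp add: sum_subtractf[symmetric] shanks_term_step U_def)
  also have "\<dots> = U ?N - U 0"
    using sum_Suc_diff[of 0 n U] by (simp add: atLeast0AtMost)
  also have "U 0 = 0" by (simp add: U_def)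
  finally have *: "(\<Sum>s\<le>?N. shanks_term q ?N s) =
      (\<Sum>s\<le>n. shanks_term q n s) + U ?N + shanks_term q ?N ?N"
    by (simp add: algebra_simps)
  have "even (?N * (?N + 1))" by simp
  then obtain t where t: "?N * (?N + 1) = 2 * t" by (rule evenE)
  have ti: "int ?N * (int ?N + 1) = 2 * int t"
    using t by (metis of_nat_mult of_nat_add of_nat_1 of_nat_numeral)
  have "pent (int ?N) = ?N * ?N + t"
  proof -
    have "int ?N * (3 * int ?N + 1) = 2 * int (?N * ?N + t)"
      using ti by (simp add: algebra_simps)
    then show ?thesis by (rule pent_eqI)
  qed
  moreover have "pent (- int ?N) = n * ?N + t"
  proof -
    have "- int ?N * (3 * (- int ?N) + 1) = 2 * int (n * ?N + t)"
      using ti by (simp add: algebra_simps)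
    then show ?thesis by (rule pent_eqI)
  qed
  moreover have "?N * (?N + 1) div 2 = t" using t by simp
  moreover have "nat \<bar>- int ?N\<bar> = ?N" "nat \<bar>int ?N\<bar> = ?N" by auto
  ultimately have ends: "U ?N = (-1) ^ nat \<bar>- int ?N\<bar> * q ^ pent (- int ?N)"
      "shanks_term q ?N ?N = (-1) ^ nat \<bar>int ?N\<bar> * q ^ pent (int ?N)"
    unfolding U_def shanks_term_def by (simp_all del: mult_Suc mult_Suc_right of_nat_Suc power_Suc)
  have "{-int ?N..int ?N} = insert (- int ?N) (insert (int ?N) {-int n..int n})" by auto
  then show ?case unfolding * Suc.IH ends
    by (simp del: of_nat_Suc add: add_ac)
qed

section \<open>A finite form of Jacobi's identity for the cube\<close>

text \<open>
  Up to the common factor \<open>(q; q)\<^sub>K\<^sup>2\<close> this is \<open>(-1)\<^sup>m q\<^bsup>m(m+1)/2\<^esup> / ((q; q)\<^bsub>n-m\<^esub> (q; q)\<^bsub>n+m+1\<^esub>)\<close>, essentially a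
  coefficient of the finite Jacobi triple product. Clearing denominators with a bound \<open>K\<close> that stays fixed while
  \<open>n\<close> varies keeps the recurrence in \<open>n\<close> uniform. For \<open>m > n\<close> the truncated difference is 0 and the product
  contains \<open>1 - q\<^sup>0 = 0\<close>, as it should.
\<close>

definition jacobi_term :: "'a::comm_ring_1 \<Rightarrow> nat \<Rightarrow> nat \<Rightarrow> nat \<Rightarrow> 'a" where
  "jacobi_term q K n m =
     (-1) ^ m * q ^ (m * (m + 1) div 2) * qprod q (Suc n - m) K * qprod q (n + m + 2) K"

lemma jacobi_term_beyond: "n < m \<Longrightarrow> jacobi_term q K n m = 0"
  by (simp add: jacobi_term_def)

text \<open>
  Passing from \<open>n\<close> to \<open>n + 1\<close> multiplies the triple product by
  \<open>(1 - z q\<^bsup>n+1\<^esup>) (1 - q\<^bsup>n+1\<^esup> / z) = 1 + q\<^bsup>2n+2\<^esup> - q\<^bsup>n+1\<^esup> z - q\<^bsup>n+1\<^esup> / z\<close>, which yields a three-term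
  recurrence for the coefficients. The factors on its left-hand side are the ratio of \<open>(q; q)\<^bsub>2n+3\<^esub>\<close> to
  \<open>(q; q)\<^bsub>2n+1\<^esub>\<close>, which occur in the coefficients but not in \<open>jacobi_term\<close>. For \<open>m = 0\<close> the neighbour with index \<open>-1\<close> is minus the one with index 0.
\<close>
lemma jacobi_term_step_0:
  assumes "2 * n + 3 \<le> K"
  shows "(1 - q ^ (2 * n + 2)) * (1 - q ^ (2 * n + 3)) * jacobi_term q K (Suc n) 0 =
     (1 + q ^ (2 * n + 2)) * jacobi_term q K n 0 +
       q ^ Suc n * (jacobi_term q K n 0 - jacobi_term q K n 1)"
proof -
  define C where "C = qprod q (n + 2) K * qprod q (n + 3) K"
  define a where "a = q ^ n"
  have 1: "jacobi_term q K (Suc n) 0 = C"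
    using assms by (simp add: jacobi_term_def C_def eval_nat_numeral)
  have 2: "jacobi_term q K n 0 = C * (1 - a * q) * (1 - a * q * q)"
    using assms qprod_first[of "Suc n" K q] qprod_first[of "Suc (Suc n)" K q]
    by (simp add: jacobi_term_def C_def eval_nat_numeral a_def mult_ac)
  have 3: "jacobi_term q K n 1 = - q * C * (1 - a) * (1 - a * q)"
    using assms qprod_first[of "n" K q] qprod_first[of "Suc n" K q]
    by (simp add: jacobi_term_def C_def eval_nat_numeral a_def mult_ac)
  have 4: "q ^ (2 * n + 2) = a * a * q * q" "q ^ (2 * n + 3) = a * a * q * q * q" "q ^ Suc n = a * q"
    by (simp_all add: a_def power_add eval_nat_numeral mult_2 mult_ac)
  show ?thesis unfolding 1 2 3 4 by (simp add: algebra_simps)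
qed

lemma jacobi_term_step_Suc:
  assumes "2 * n + 3 \<le> K" "m \<le> n"
  shows "(1 - q ^ (2 * n + 2)) * (1 - q ^ (2 * n + 3)) * jacobi_term q K (Suc n) (Suc m) =
     (1 + q ^ (2 * n + 2)) * jacobi_term q K n (Suc m) -
       q ^ Suc n * (jacobi_term q K n m + jacobi_term q K n (Suc (Suc m)))"
proof -
  define l where "l = n - m"
  have n: "n = m + l" using assms(2) by (simp add: l_def)
  define t where "t = m * (m + 1) div 2"
  define C where "C = (-1) ^ m * q ^ t * qprod q (Suc l) K * qprod q (n + m + 4) K"
  define a b c where "a = q ^ l" and "b = q ^ (n + m)" and "c = q ^ m"
  have t1: "Suc m * (Suc m + 1) div 2 = t + Suc m"
    by (simp only: triangular_Suc t_def)
  have t2: "Suc (Suc m) * (Suc (Suc m) + 1) div 2 = t + Suc m + Suc (Suc m)"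
    by (simp only: triangular_Suc t_def)
  have Q1: "qprod q (n + m + 2) K = (1 - b * q * q) * (1 - b * q * q * q) * qprod q (n + m + 4) K"
    and Q2: "qprod q (n + m + 3) K = (1 - b * q * q * q) * qprod q (n + m + 4) K"
    using assms qprod_first[of "n + m + 2" K q] qprod_first[of "n + m + 3" K q]
    by (simp_all add: eval_nat_numeral b_def mult_ac)
  have Q3: "qprod q l K = (1 - a) * qprod q (Suc l) K"
    using assms qprod_first[of l K q] by (simp add: n a_def)
  have Q4: "q * qprod q (l - 1) K = (q - a) * (1 - a) * qprod q (Suc l) K"
  proof (cases l)
    case (Suc l')
    then have "qprod q l' K = (1 - q ^ l') * qprod q l K"
      using assms qprod_first[of l' K q] by (simp add: n)
    then have "q * qprod q l' K = (q - a) * qprod q l K"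
      using Suc by (simp only: a_def power_Suc left_diff_distrib) (simp add: algebra_simps)
    then show ?thesis using Suc Q3 by (simp add: mult_ac)
  qed (simp add: a_def)
  have s: "Suc (Suc n) - Suc m = Suc l" "Suc n - Suc m = l" "Suc n - m = Suc l"
      "Suc n - Suc (Suc m) = l - 1"
    using assms(2) by (auto simp: l_def)
  have e: "Suc n + Suc m + 2 = n + m + 4" "n + Suc m + 2 = n + m + 3" "n + Suc (Suc m) + 2 = n + m + 4"
    by auto
  have 1: "jacobi_term q K (Suc n) (Suc m) = - C * q * c"
    unfolding jacobi_term_def s e t1 by (simp add: C_def power_add c_def mult_ac)
  have 2: "jacobi_term q K n (Suc m) = - C * q * c * (1 - a) * (1 - b * q * q * q)"
    unfolding jacobi_term_def s e t1 Q2 Q3 by (simp add: C_def power_add c_def mult_ac)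
  have 3: "jacobi_term q K n m = C * (1 - b * q * q) * (1 - b * q * q * q)"
    unfolding jacobi_term_def s e Q1 by (simp add: C_def t_def mult_ac)
  have "jacobi_term q K n (Suc (Suc m)) =
      (-1) ^ m * q ^ t * c * c * q * q * (q * qprod q (l - 1) K) * qprod q (n + m + 4) K"
    unfolding jacobi_term_def s e t2 by (simp add: power_add c_def mult_ac)
  then have 4: "jacobi_term q K n (Suc (Suc m)) = C * c * c * q * q * (q - a) * (1 - a)"
    unfolding Q4 by (simp add: C_def mult_ac)
  have 5: "q ^ (2 * n + 2) = a * b * q * q" "q ^ (2 * n + 3) = a * b * q * q * q"
      "q ^ Suc n = a * c * q"
    by (simp_all add: a_def b_def c_def n power_add eval_nat_numeral mult_2 mult_ac)
  have 6: "b = a * c * c" by (simp add: a_def b_def c_def n power_add mult_ac)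
  show ?thesis unfolding 1 2 3 4 5 unfolding 6 by (simp add: algebra_simps)
qed

text \<open>
  Weighting by \<open>2 m + 1\<close> corresponds to differentiating the triple product at its zero \<open>z = 1\<close>. Since
  \<open>1 + q\<^bsup>2n+2\<^esup> = (1 - q\<^bsup>n+1\<^esup>)\<^sup>2 + 2 q\<^bsup>n+1\<^esup>\<close>, the recurrence splits into multiplication by
  \<open>(1 - q\<^bsup>n+1\<^esup>)\<^sup>2\<close> and a second difference, whose product with the linear weight telescopes.
  Since \<open>q\<close> is not a root of unity, the factors on the left of the recurrence can be cancelled.
\<close>
theorem finite_jacobi_identity:
  fixes q :: "'a::idom"
  assumes q: "\<And>i. i > 0 \<Longrightarrow> q ^ i \<noteq> 1"
  shows "2 * n + 1 \<le> K \<Longrightarrow> (\<Sum>m\<le>n. of_nat (2 * m + 1) * jacobi_term q K n m) =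
     (qprod q 1 n)\<^sup>2 * qprod q 1 K * qprod q (2 * n + 2) K"
proof (induction n)
  case 0
  then show ?case by (simp add: jacobi_term_def numeral_2_eq_2)
next
  case (Suc n)
  let ?b = "jacobi_term q K n" and ?N = "Suc n"
  define D where "D = (1 - q ^ (2 * n + 2)) * (1 - q ^ (2 * n + 3))"
  (* summation by parts: the second difference of the terms against the weight 2 m + 1 is a difference of R *)
  define R where "R = (\<lambda>m. if m = 0 then 0 else of_nat (2 * m + 1) * ?b (m - 1) - of_nat (2 * m - 1) * ?b m)"
  have step: "D * (of_nat (2 * m + 1) * jacobi_term q K ?N m) =
      (1 - q ^ ?N)\<^sup>2 * (of_nat (2 * m + 1) * ?b m) + q ^ ?N * (R (Suc m) - R m)" if "m \<le> ?N" for m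
  proof (cases m)
    case 0
    have e: "q ^ (2 * n + 2) = (q ^ ?N)\<^sup>2"
      by (simp add: power2_eq_square mult_2 mult_2_right power_add mult_ac)
    have "D * jacobi_term q K ?N 0 = (1 + q ^ (2 * n + 2)) * ?b 0 + q ^ ?N * (?b 0 - ?b 1)"
      unfolding D_def using Suc.prems by (intro jacobi_term_step_0) simp
    then show ?thesis unfolding 0 e by (simp add: R_def algebra_simps power2_eq_square)
  next
    case (Suc m')
    have e: "q ^ (2 * n + 2) = (q ^ ?N)\<^sup>2"
      by (simp add: power2_eq_square mult_2 mult_2_right power_add mult_ac)
    have "D * jacobi_term q K ?N (Suc m') = (1 + q ^ (2 * n + 2)) * ?b (Suc m') -
        q ^ ?N * (?b m' + ?b (Suc (Suc m')))"
      unfolding D_def using Suc.prems Suc that by (intro jacobi_term_step_Suc) auto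
    then have lhs: "D * (of_nat (2 * m + 1) * jacobi_term q K ?N m) =
        of_nat (2 * m + 1) * ((1 + (q ^ ?N)\<^sup>2) * ?b m - q ^ ?N * (?b m' + ?b (Suc m)))"
      unfolding Suc e by (simp only: mult.left_commute[of D])
    have R: "R (Suc m) - R m = of_nat (2 * m + 1) * (2 * ?b m - ?b m' - ?b (Suc m))"
      by (simp add: R_def Suc algebra_simps)
    show ?thesis unfolding lhs R by (simp add: algebra_simps power2_eq_square)
  qed
  have "D * (\<Sum>m\<le>?N. of_nat (2 * m + 1) * jacobi_term q K ?N m) =
      (1 - q ^ ?N)\<^sup>2 * (\<Sum>m\<le>?N. of_nat (2 * m + 1) * ?b m) + q ^ ?N * (\<Sum>m\<le>?N. R (Suc m) - R m)"
    by (simp only: sum_distrib_left sum.distrib[symmetric]) (rule sum.cong, auto simp only: atMost_iff step)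
  also have "(\<Sum>m\<le>?N. R (Suc m) - R m) = R (Suc ?N) - R 0"
    using sum_Suc_diff[of 0 ?N R] by (simp add: atLeast0AtMost)
  also have "\<dots> = 0" by (simp add: R_def jacobi_term_beyond)
  also have "(\<Sum>m\<le>?N. of_nat (2 * m + 1) * ?b m) = (\<Sum>m\<le>n. of_nat (2 * m + 1) * ?b m)"
    by (simp add: jacobi_term_beyond)
  also have "\<dots> = (qprod q 1 n)\<^sup>2 * qprod q 1 K * qprod q (2 * n + 2) K"
    using Suc by simp
  also have "qprod q (2 * n + 2) K = D * qprod q (2 * ?N + 2) K"
    using Suc.prems qprod_first[of "2*n+2" K q] qprod_first[of "2*n+3" K q]
    by (simp add: D_def eval_nat_numeral mult_ac)
  finally have "D * (\<Sum>m\<le>?N. of_nat (2 * m + 1) * jacobi_term q K ?N m) =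
      D * ((qprod q 1 ?N)\<^sup>2 * qprod q 1 K * qprod q (2 * ?N + 2) K)"
    by (simp add: qprod_last power_mult_distrib mult_ac)
  moreover have "D \<noteq> 0" using q[of "2*n+2"] q[of "2*n+3"] by (simp add: D_def)
  ultimately show ?case by simp
qed

section \<open>Congruences in a commutative ring\<close>

text \<open>
  One notion serves two purposes for power series: with modulus 5 it is congruence of all coefficients, with
  modulus \<open>q\<^sup>n\<close> it is agreement of the coefficients below \<open>n\<close>.
\<close>

definition ring_cong :: "'a::comm_ring_1 \<Rightarrow> 'a \<Rightarrow> 'a \<Rightarrow> bool" where
  "ring_cong m a b \<longleftrightarrow> m dvd a - b"

lemma ring_cong_refl [simp]: "ring_cong m a a"
  by (simp add: ring_cong_def)

lemma ring_cong_sym: "ring_cong m a b \<Longrightarrow> ring_cong m b a"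
  unfolding ring_cong_def by (metis dvd_minus_iff minus_diff_eq)

lemma ring_cong_trans [trans]: "ring_cong m a b \<Longrightarrow> ring_cong m b c \<Longrightarrow> ring_cong m a c"
  unfolding ring_cong_def by (metis diff_add_cancel dvd_add add_diff_eq)

lemma ring_cong_mult:
  assumes "ring_cong m a b" "ring_cong m c d" shows "ring_cong m (a * c) (b * d)"
proof -
  have "a * c - b * d = (a - b) * c + b * (c - d)" by (simp add: algebra_simps)
  with assms show ?thesis by (simp add: ring_cong_def)
qed

lemma ring_cong_power: "ring_cong m a b \<Longrightarrow> ring_cong m (a ^ k) (b ^ k)"
  by (induction k) (auto intro: ring_cong_mult)

lemma ring_cong_prod:
  "(\<And>i. i \<in> A \<Longrightarrow> ring_cong m (f i) (g i)) \<Longrightarrow> ring_cong m (prod f A) (prod g A)"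
  by (induction A rule: infinite_finite_induct) (auto intro: ring_cong_mult)

lemma ring_cong_sum:
  "(\<And>i. i \<in> A \<Longrightarrow> ring_cong m (f i) (g i)) \<Longrightarrow> ring_cong m (sum f A) (sum g A)"
  unfolding ring_cong_def sum_subtractf[symmetric] by (rule dvd_sum)

lemma ring_cong_dvd_mono: "ring_cong m a b \<Longrightarrow> m' dvd m \<Longrightarrow> ring_cong m' a b"
  unfolding ring_cong_def by (rule dvd_trans)

lemma ring_cong_X_power_iff:
  "ring_cong (fps_X ^ n) f g \<longleftrightarrow> (\<forall>k<n. f $ k = (g $ k :: 'a::comm_ring_1))"
proof
  assume "ring_cong (fps_X ^ n) f g"
  then obtain h where "f - g = fps_X ^ n * h" by (auto simp: ring_cong_def)
  then have "(f - g) $ k = 0" if "k < n" for k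
    using that by (simp add: fps_X_power_mult_nth)
  then show "\<forall>k<n. f $ k = g $ k" by simp
next
  assume *: "\<forall>k<n. f $ k = g $ k"
  have "f - g = fps_X ^ n * fps_shift n (f - g)"
    by (rule fps_ext) (use * in \<open>auto simp: fps_X_power_mult_nth\<close>)
  then show "ring_cong (fps_X ^ n) f g" unfolding ring_cong_def by (metis dvd_triv_left)
qed

lemma ring_cong_numeral_fps_nth:
  "ring_cong (numeral m) f g \<Longrightarrow> numeral m dvd (f $ n - g $ n :: int)"
  unfolding ring_cong_def by (metis dvd_def fps_mult_left_const_nth fps_sub_nth numeral_fps_const)

section \<open>Euler's product and the expansions of Euler and Jacobi\<close>

lemma qprod_cong_1: "ring_cong (q ^ n) (qprod q n K) 1"
proof -
  have "ring_cong (q ^ n) (\<Prod>i=n..K. 1 - q ^ i) (\<Prod>i=n..K. 1)"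
    by (rule ring_cong_prod) (simp add: ring_cong_def le_imp_power_dvd)
  then show ?thesis by (simp add: qprod_def)
qed

lemma qprod_split: "n \<le> N \<Longrightarrow> qprod q 1 N = qprod q 1 n * qprod q (Suc n) N"
proof -
  assume "n \<le> N"
  then have "{1..N} = {1..n} \<union> {Suc n..N}" by auto
  then show ?thesis unfolding qprod_def by (simp add: prod.union_disjoint)
qed

lemma qprod_truncate: "n \<le> N \<Longrightarrow> ring_cong (q ^ Suc n) (qprod q 1 N) (qprod q 1 n)"
  using ring_cong_mult[OF ring_cong_refl[of _ "qprod q 1 n"] qprod_cong_1[of q "Suc n" N]]
  by (simp add: qprod_split del: One_nat_def)

text \<open>
  The infinite product \<open>(q; q)\<^sub>\<infinity>\<close>. Its coefficient at \<open>n\<close> may be read off the product of the first \<open>n\<close> factors,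
  because later factors are 1 modulo \<open>q\<^bsup>n+1\<^esup>\<close>.
\<close>
definition euler :: "int fps" where
  "euler = Abs_fps (\<lambda>n. qprod fps_X 1 n $ n)"

lemma euler_cong: "n \<le> N \<Longrightarrow> ring_cong (fps_X ^ Suc n) euler (qprod fps_X 1 N)"
  unfolding ring_cong_X_power_iff
proof (intro allI impI)
  fix k assume "n \<le> N" "k < Suc n"
  then have "ring_cong (fps_X ^ Suc k) (qprod (fps_X :: int fps) 1 N) (qprod fps_X 1 k)"
    by (intro qprod_truncate) simp
  then show "euler $ k = qprod fps_X 1 N $ k"
    unfolding ring_cong_X_power_iff euler_def by (metis fps_nth_Abs_fps lessI)
qed

lemma sum_powers_nth:
  "(\<Sum>s\<in>A. of_int (c s) * fps_X ^ e s) $ n = (\<Sum>s\<in>A. if e s = n then c s else 0 :: int)"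
proof -
  have "(of_int (c s) * fps_X ^ e s) $ n = (if e s = n then c s else 0)" for s
    by (simp flip: fps_of_int)
  then show ?thesis by (simp add: fps_sum_nth)
qed

text \<open>
  Shanks's identity modulo \<open>q\<^bsup>n+1\<^esup>\<close>: the terms with \<open>s > 0\<close> have order at least \<open>n + 1\<close>.
\<close>
lemma euler_nth_truncated:
  "euler $ n = (\<Sum>j\<in>{-int n..int n}. if pent j = n then (-1) ^ nat \<bar>j\<bar> else 0)"
proof -
  let ?X = "fps_X :: int fps"
  have "ring_cong (?X ^ Suc n) (shanks_term ?X n s) (if s = 0 then qprod ?X 1 n else 0)" if "s \<le> n" for s
  proof (cases s)
    case (Suc s')
    have "?X ^ Suc n dvd shanks_term ?X n s"
      unfolding shanks_term_def
    proof (intro dvd_mult le_imp_power_dvd)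
      show "Suc n \<le> n * s + s * (s + 1) div 2"
        unfolding Suc triangular_Suc by simp
    qed
    with Suc show ?thesis by (simp add: ring_cong_def del: power_Suc)
  qed (simp add: shanks_term_def del: power_Suc)
  then have "ring_cong (?X ^ Suc n) (\<Sum>s\<le>n. shanks_term ?X n s) (\<Sum>s\<le>n. if s = 0 then qprod ?X 1 n else 0)"
    by (intro ring_cong_sum) auto
  then have "ring_cong (?X ^ Suc n) (\<Sum>j\<in>{-int n..int n}. (-1) ^ nat \<bar>j\<bar> * ?X ^ pent j) (qprod ?X 1 n)"
    unfolding shanks_identity by (simp del: power_Suc)
  with euler_cong[of n n] have "ring_cong (?X ^ Suc n) euler (\<Sum>j\<in>{-int n..int n}. (-1) ^ nat \<bar>j\<bar> * ?X ^ pent j)"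
    by (meson le_refl ring_cong_sym ring_cong_trans)
  then have "euler $ n = (\<Sum>j\<in>{-int n..int n}. of_int ((-1) ^ nat \<bar>j\<bar>) * ?X ^ pent j) $ n"
    unfolding ring_cong_X_power_iff by simp
  then show ?thesis unfolding sum_powers_nth .
qed

text \<open>
  Jacobi's identity, from its finite form with \<open>K = 2 n + 1\<close> modulo \<open>q\<^bsup>n+1\<^esup>\<close>. The right-hand side of the finite
  form then is \<open>E\<^sup>3\<close>. On the left, the products inside the term with index \<open>m\<close> are 1 modulo \<open>q\<^bsup>n+1-m\<^esup>\<close>, and the factor
  \<open>q\<^bsup>m(m+1)/2\<^esup>\<close> makes up for the missing \<open>m\<close>.
\<close>
theorem euler_cube_nth:
  "(euler ^ 3) $ n = (\<Sum>m\<le>n. if m * (m + 1) div 2 = n then (-1) ^ m * int (2 * m + 1) else 0)"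
proof -
  let ?X = "fps_X :: int fps" and ?K = "2 * n + 1"
  let ?t = "\<lambda>m::nat. m * (m + 1) div 2"
  have "ring_cong (?X ^ Suc n) (of_nat (2 * m + 1) * jacobi_term ?X ?K n m)
      (of_nat (2 * m + 1) * ((-1) ^ m * ?X ^ ?t m))" if "m \<le> n" for m
  proof -
    have "ring_cong (?X ^ (Suc n - m)) (qprod ?X (Suc n - m) ?K * qprod ?X (n + m + 2) ?K) (1 * 1)"
      by (intro ring_cong_mult qprod_cong_1 ring_cong_dvd_mono[OF qprod_cong_1 le_imp_power_dvd]) simp
    then obtain h where h: "qprod ?X (Suc n - m) ?K * qprod ?X (n + m + 2) ?K = 1 + ?X ^ (Suc n - m) * h"
      unfolding ring_cong_def dvd_def by (metis add.commute diff_eq_eq mult_1)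
    have "m \<le> ?t m"
    proof (cases m)
      case (Suc m') then show ?thesis unfolding Suc triangular_Suc by simp
    qed simp
    then have "Suc n \<le> ?t m + (Suc n - m)" by linarith
    then have d: "?X ^ Suc n dvd ?X ^ ?t m * ?X ^ (Suc n - m)"
      by (metis le_imp_power_dvd power_add)
    have "jacobi_term ?X ?K n m - (-1) ^ m * ?X ^ ?t m = (-1) ^ m * (?X ^ ?t m * ?X ^ (Suc n - m)) * h"
      unfolding jacobi_term_def mult.assoc h by (simp only: ring_distribs mult_1_right add_diff_cancel_left')
    then have "ring_cong (?X ^ Suc n) (jacobi_term ?X ?K n m) ((-1) ^ m * ?X ^ ?t m)"
      unfolding ring_cong_def using d by (simp only: dvd_mult dvd_mult2)
    then show ?thesis by (intro ring_cong_mult ring_cong_refl)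
  qed
  then have 1: "ring_cong (?X ^ Suc n) (\<Sum>m\<le>n. of_nat (2 * m + 1) * jacobi_term ?X ?K n m)
      (\<Sum>m\<le>n. of_nat (2 * m + 1) * ((-1) ^ m * ?X ^ ?t m))"
    by (intro ring_cong_sum) auto
  have "?X ^ i \<noteq> 1" if "i > 0" for i
  proof
    assume "?X ^ i = 1"
    then have "(?X ^ i) $ 0 = 1 $ 0" by (rule arg_cong)
    with that show False by simp
  qed
  then have "(\<Sum>m\<le>n. of_nat (2 * m + 1) * jacobi_term ?X ?K n m) =
      qprod ?X 1 n ^ 2 * qprod ?X 1 ?K * qprod ?X (2 * n + 2) ?K"
    by (rule finite_jacobi_identity) auto
  then have 2: "(\<Sum>m\<le>n. of_nat (2 * m + 1) * jacobi_term ?X ?K n m) = qprod ?X 1 n ^ 2 * qprod ?X 1 ?K"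
    by (simp del: One_nat_def)
  have "ring_cong (?X ^ Suc n) (euler ^ 2 * euler) (qprod ?X 1 n ^ 2 * qprod ?X 1 ?K)"
    by (intro ring_cong_mult ring_cong_power euler_cong) auto
  also note 1[unfolded 2]
  finally have "(euler ^ 2 * euler) $ n = (\<Sum>m\<le>n. of_nat (2 * m + 1) * ((-1) ^ m * ?X ^ ?t m)) $ n"
    unfolding ring_cong_X_power_iff by blast
  also have "(\<Sum>m\<le>n. of_nat (2 * m + 1) * ((-1) ^ m * ?X ^ ?t m)) =
      (\<Sum>m\<le>n. of_int ((-1) ^ m * int (2 * m + 1)) * ?X ^ ?t m)"
    by (rule sum.cong) (simp_all only: of_int_mult of_int_power of_int_minus of_int_1 of_int_of_nat_eq mult_ac)
  also have "\<dots> $ n = (\<Sum>m\<le>n. if ?t m = n then (-1) ^ m * int (2 * m + 1) else 0)"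
    by (rule sum_powers_nth)
  also have "euler ^ 2 * euler = euler ^ 3" by (simp add: power2_eq_square power3_eq_cube)
  finally show ?thesis .
qed

section \<open>Substitution of powers and residue classes of exponents\<close>

abbreviation expand :: "nat \<Rightarrow> int fps \<Rightarrow> int fps" where
  "expand d f \<equiv> f oo fps_X ^ d"

lemma expand_nth:
  assumes "d > 0"
  shows "expand d f $ n = (if d dvd n then f $ (n div d) else 0)"
proof -
  have "expand d f $ n = (\<Sum>i=0..n. if n = d * i then f $ i else 0)"
    by (simp add: fps_compose_nth flip: power_mult) (rule sum.cong, auto)
  also have "\<dots> = (\<Sum>i=0..n. if i = n div d \<and> d dvd n then f $ i else 0)"
    using assms by (intro sum.cong) auto
  also have "\<dots> = (if d dvd n then f $ (n div d) else 0)"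
    by (cases "d dvd n") (simp_all add: sum.delta)
  finally show ?thesis .
qed

lemma expand_mult: "d > 0 \<Longrightarrow> expand d (f * g) = expand d f * expand d g"
  by (rule fps_compose_mult_distrib) simp

lemma expand_power: "d > 0 \<Longrightarrow> expand d (f ^ k) = expand d f ^ k"
  by (rule fps_compose_power[symmetric]) simp

lemma expand_expand: "d > 0 \<Longrightarrow> e > 0 \<Longrightarrow> expand d (expand e f) = expand (d * e) f"
  by (rule fps_ext) (auto simp: expand_nth div_mult2_eq dest: dvd_mult_left elim!: dvdE)

lemma expand_qprod: "d > 0 \<Longrightarrow> expand d (qprod fps_X a b) = qprod (fps_X ^ d) a b"
  by (simp add: qprod_def fps_compose_prod_distrib fps_compose_sub_distrib fps_X_power_compose fps_compose_1)

text \<open>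
  The series has all its exponents in the residue classes \<open>S\<close> mod 5, if coefficients divisible by \<open>m\<close> are
  ignored. For \<open>m = 0\<close> nothing is ignored, and the statement is about the support over the integers.
\<close>
definition vanishes_off :: "int \<Rightarrow> nat set \<Rightarrow> int fps \<Rightarrow> bool" where
  "vanishes_off m S f \<longleftrightarrow> (\<forall>n. n mod 5 \<notin> S \<longrightarrow> m dvd f $ n)"

lemma vanishes_offD: "vanishes_off m S f \<Longrightarrow> n mod 5 \<notin> S \<Longrightarrow> m dvd f $ n"
  by (simp add: vanishes_off_def)

lemma vanishes_off_weaken: "vanishes_off 0 S f \<Longrightarrow> S \<subseteq> T \<Longrightarrow> vanishes_off m T f"
  by (fastforce simp: vanishes_off_def)

lemma vanishes_off_add:
  "vanishes_off m S f \<Longrightarrow> vanishes_off m S g \<Longrightarrow> vanishes_off m S (f + g)"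
  by (simp add: vanishes_off_def)

lemma vanishes_off_diff:
  "vanishes_off m S f \<Longrightarrow> vanishes_off m S g \<Longrightarrow> vanishes_off m S (f - g)"
  by (simp add: vanishes_off_def)

lemma vanishes_off_numeral: "vanishes_off m S f \<Longrightarrow> vanishes_off m S (numeral c * f)"
  by (simp add: vanishes_off_def numeral_fps_const)

lemma vanishes_off_mult:
  assumes "vanishes_off m S f" "vanishes_off m T g"
    and "\<And>s t. s \<in> S \<Longrightarrow> t \<in> T \<Longrightarrow> (s + t) mod 5 \<in> U"
  shows "vanishes_off m U (f * g)"
  unfolding vanishes_off_def
proof (intro allI impI)
  fix n :: nat assume n: "n mod 5 \<notin> U"
  have "m dvd f $ i * g $ (n - i)" if "i \<le> n" for i
  proof (cases "i mod 5 \<in> S \<and> (n - i) mod 5 \<in> T")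
    case True
    then have "(i mod 5 + (n - i) mod 5) mod 5 \<in> U" by (intro assms(3)) auto
    with that n show ?thesis by (simp add: mod_add_eq)
  next
    case False
    then show ?thesis using assms(1,2) by (auto simp: vanishes_off_def)
  qed
  then show "m dvd (f * g) $ n" unfolding fps_mult_nth by (intro dvd_sum) simp
qed

lemma vanishes_off_expand: "5 dvd d \<Longrightarrow> d > 0 \<Longrightarrow> vanishes_off m {0} (expand d f)"
  unfolding vanishes_off_def by (auto simp: expand_nth mod_eq_0_iff_dvd dest: dvd_trans)

lemma vanishes_off_cong:
  "ring_cong 5 f g \<Longrightarrow> vanishes_off 5 S g \<Longrightarrow> vanishes_off 5 S f"
  unfolding vanishes_off_def by (metis ring_cong_numeral_fps_nth dvd_add diff_add_cancel)

section \<open>Exponents occurring in Euler's product and its cube\<close>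

lemma pent_eq_iff: "pent j = n \<longleftrightarrow> j * (3 * j + 1) = 2 * int n"
proof
  have "even (j * (3 * j + 1))" by simp
  moreover have "j * (3 * j + 1) \<ge> 0"
    by (cases "j \<ge> 0") (auto intro: mult_nonpos_nonpos)
  moreover assume "pent j = n"
  ultimately show "j * (3 * j + 1) = 2 * int n" by (auto simp: pent_def)
qed (rule pent_eqI)

lemma abs_le_pent: "\<bar>j\<bar> \<le> int (pent j)"
proof -
  have "2 * \<bar>j\<bar> \<le> j * (3 * j + 1)"
  proof (cases "j \<ge> 0")
    case True
    then have "j * 1 \<le> j * j" by (cases "j = 0") (auto intro: mult_left_mono)
    with True show ?thesis by (simp add: algebra_simps)
  next
    case False
    then have "(- j) * 1 \<le> (- j) * (- j)" by (intro mult_left_mono) auto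
    with False show ?thesis by (simp add: algebra_simps)
  qed
  then show ?thesis using pent_eq_iff[of j "pent j"] by simp
qed

theorem euler_nth: "euler $ n = (\<Sum>j | pent j = n. (-1) ^ nat \<bar>j\<bar>)"
proof -
  have "{j. pent j = n} = {j \<in> {-int n..int n}. pent j = n}"
    using abs_le_pent by (auto simp: abs_le_iff) (metis minus_le_iff)+
  then show ?thesis by (simp only: euler_nth_truncated sum.inter_filter finite_atLeastAtMost_int)
qed

lemma double_pent_mod_5: "(2 * int (pent j)) mod 5 = ((j mod 5) * (3 * (j mod 5) + 1)) mod 5"
proof -
  have "2 * int (pent j) = j * (3 * j + 1)"
    using pent_eq_iff[of j "pent j"] by simp
  moreover have "(3 * j + 1) mod 5 = (3 * (j mod 5) + 1) mod 5"
    by (metis mod_add_left_eq mod_mult_right_eq)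
  then have "(j * (3 * j + 1)) mod 5 = ((j mod 5) * (3 * (j mod 5) + 1)) mod 5"
    by (rule mod_mult_cong[rotated]) simp
  ultimately show ?thesis by simp
qed

lemma pent_mod_5: "pent j mod 5 \<in> {0, 1, 2}"
proof -
  have "j mod 5 \<in> {0, 1, 2, 3, 4}" by auto
  then have "(2 * int (pent j)) mod 5 \<in> {0, 4, 2}" unfolding double_pent_mod_5 by auto
  moreover have "(2 * int (pent j)) mod 5 = (2 * (int (pent j) mod 5)) mod 5" by (simp add: mod_simps)
  moreover have "int (pent j) mod 5 \<in> {0, 1, 2, 3, 4}" by auto
  ultimately have "int (pent j mod 5) \<in> {0, 1, 2}" by (auto simp: zmod_int)
  then show ?thesis by auto
qed

lemma vanishes_off_euler: "vanishes_off 0 {0, 1, 2} euler"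
  unfolding vanishes_off_def
proof (intro allI impI)
  fix n :: nat assume "n mod 5 \<notin> {0, 1, 2}"
  then have "{j. pent j = n} = {}" using pent_mod_5 by blast
  then show "0 dvd euler $ n" by (simp add: euler_nth)
qed

text \<open>
  If \<open>j (3 j + 1) = 2 N\<close>, then \<open>24 N + 1 = (6 j + 1)\<^sup>2\<close>. For \<open>N = 1\<close> mod 5 the left-hand side is divisible by 5,
  hence so is \<open>6 j + 1\<close>, which fixes \<open>j\<close> mod 5. The parametrisation is chosen to make \<open>pent_dilate\<close> hold.
\<close>
lemma pent_eq_1_mod_5:
  assumes "pent j mod 5 = 1"
  obtains i where "j = -1 - 5 * i"
proof -
  have "(2 * int (pent j)) mod 5 = (2 * int (pent j mod 5)) mod 5" by (simp add: zmod_int mod_simps)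
  then have "(2 * int (pent j)) mod 5 = 2" using assms by simp
  then have "((j mod 5) * (3 * (j mod 5) + 1)) mod 5 = 2" unfolding double_pent_mod_5 .
  moreover have "j mod 5 \<in> {0, 1, 2, 3, 4}" by auto
  ultimately have "j mod 5 = 4" by auto
  then have "j = -1 - 5 * (- (j div 5) - 1)" by presburger
  then show ?thesis by (rule that)
qed

lemma pent_dilate: "pent (-1 - 5 * i) = 25 * pent i + 1"
proof -
  have "i * (3 * i + 1) = 2 * int (pent i)" using pent_eq_iff[of i "pent i"] by simp
  then show ?thesis by (intro pent_eqI) (simp add: algebra_simps)
qed

lemma sign_dilate: "(-1::int) ^ nat \<bar>-1 - 5 * i\<bar> = - ((-1) ^ nat \<bar>i\<bar>)"
proof -
  have "even (nat \<bar>-1 - 5 * i\<bar>) \<longleftrightarrow> odd (nat \<bar>i\<bar>)" by (simp add: even_nat_iff)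
  then show ?thesis by (auto simp: minus_one_power_iff)
qed

text \<open>
  The pentagonal numbers in the class 1 mod 5 are a copy of all pentagonal numbers, scaled by 25, and the
  substitution \<open>j = -1 - 5 i\<close> reverses the sign.
\<close>
lemma euler_nth_1_mod_5:
  assumes "n mod 5 = 1"
  shows "euler $ n = (if n mod 25 = 1 then - euler $ (n div 25) else 0)"
proof (cases "n mod 25 = 1")
  case True
  then have n: "n = 25 * (n div 25) + 1" using div_mult_mod_eq[of n 25] by simp
  define k where "k = n div 25"
  have "euler $ n = (\<Sum>j | pent j = k. - ((-1) ^ nat \<bar>j\<bar>))"
    unfolding euler_nth
  proof (rule sum.reindex_bij_witness[where i = "\<lambda>i. -1 - 5 * i" and j = "\<lambda>j. (-1 - j) div 5"])
    fix j assume j: "j \<in> {j. pent j = n}"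
    then have "pent j mod 5 = 1" using assms by simp
    then obtain i where i: "j = -1 - 5 * i" by (rule pent_eq_1_mod_5)
    then show "-1 - 5 * ((-1 - j) div 5) = j" by simp
    show "(-1 - j) div 5 \<in> {j. pent j = k}" using j n i by (simp add: pent_dilate k_def)
    show "- ((-1) ^ nat \<bar>(-1 - j) div 5\<bar>) = (-1::int) ^ nat \<bar>j\<bar>" unfolding i sign_dilate by simp
  next
    fix i assume "i \<in> {j. pent j = k}"
    then show "-1 - 5 * i \<in> {j. pent j = n}" using n by (simp add: pent_dilate k_def)
  qed simp
  then show ?thesis using True by (simp add: euler_nth k_def sum_negf)
next
  case False
  have "pent j \<noteq> n" for j
  proof
    assume j: "pent j = n"
    then have "pent j mod 5 = 1" using assms by simp
    then obtain i where "j = -1 - 5 * i" by (rule pent_eq_1_mod_5)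
    with j have "n = 25 * pent i + 1" by (simp add: pent_dilate)
    with False show False by simp
  qed
  then have "{j. pent j = n} = {}" by blast
  with False show ?thesis by (simp add: euler_nth)
qed

lemma triangular_mod_5:
  fixes m :: nat
  shows "m * (m + 1) div 2 mod 5 \<in> {0, 1, 3}"
    and "m * (m + 1) div 2 mod 5 = 3 \<Longrightarrow> 5 dvd 2 * m + 1"
proof -
  define t where "t = m * (m + 1) div 2"
  have "even (m * (m + 1))" by simp
  then have 2: "m * (m + 1) = 2 * t" by (simp add: t_def)
  have "(m + 1) mod 5 = (m mod 5 + 1) mod 5" by (simp only: mod_add_left_eq)
  then have "(m * (m + 1)) mod 5 = ((m mod 5) * (m mod 5 + 1)) mod 5"
    by (rule mod_mult_cong[rotated]) simp
  then have 1: "(2 * t) mod 5 = ((m mod 5) * (m mod 5 + 1)) mod 5" unfolding 2 .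
  have m: "m mod 5 \<in> {0, 1, 2, 3, 4}" by auto
  have "(2 * t) mod 5 = (2 * (t mod 5)) mod 5" by (simp add: mod_simps)
  moreover have "t mod 5 \<in> {0, 1, 2, 3, 4}" by auto
  ultimately show "m * (m + 1) div 2 mod 5 \<in> {0, 1, 3}" using 1 m unfolding t_def[symmetric] by auto
  show "5 dvd 2 * m + 1" if "m * (m + 1) div 2 mod 5 = 3"
  proof -
    have "(2 * t) mod 5 = (2 * (t mod 5)) mod 5" by (simp add: mod_simps)
    with that have "(2 * t) mod 5 = 1" unfolding t_def[symmetric] by simp
    then have "((m mod 5) * (m mod 5 + 1)) mod 5 = 1" unfolding 1 .
    with m have "m mod 5 = 2" by (elim insertE emptyE; simp)
    then show ?thesis by presburger
  qed
qed

text \<open>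
  Triangular numbers are 0, 1 or 3 mod 5. They are 3 mod 5 only if \<open>m = 2\<close> mod 5, and then the coefficient
  \<open>2 m + 1\<close> is a multiple of 5.
\<close>
lemma vanishes_off_euler_cube:
  "vanishes_off 0 {0, 1, 3} (euler ^ 3)" "vanishes_off 5 {0, 1} (euler ^ 3)"
proof -
  show "vanishes_off 0 {0, 1, 3} (euler ^ 3)"
    unfolding vanishes_off_def euler_cube_nth
  proof (intro allI impI dvd_sum)
    fix n m :: nat assume "n mod 5 \<notin> {0, 1, 3}"
    then have "m * (m + 1) div 2 \<noteq> n" using triangular_mod_5(1)[of m] by auto
    then show "0 dvd (if m * (m + 1) div 2 = n then (-1) ^ m * int (2 * m + 1) else 0)" by simp
  qed
  show "vanishes_off 5 {0, 1} (euler ^ 3)"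
    unfolding vanishes_off_def euler_cube_nth
  proof (intro allI impI dvd_sum)
    fix n m :: nat assume n: "n mod 5 \<notin> {0, 1}"
    have "5 dvd int (2 * m + 1)" if "m * (m + 1) div 2 = n"
      using that n triangular_mod_5[of m] by (metis insert_iff of_nat_dvd_iff of_nat_numeral)
    then show "5 dvd (if m * (m + 1) div 2 = n then (-1) ^ m * int (2 * m + 1) else 0)" by simp
  qed
qed

section \<open>The dissection of Euler's product modulo 5\<close>

definition component :: "nat \<Rightarrow> int fps \<Rightarrow> int fps" where
  "component i f = Abs_fps (\<lambda>n. if n mod 5 = i then f $ n else 0)"

lemma vanishes_off_component: "vanishes_off m {i} (component i f)"
  by (simp add: vanishes_off_def component_def)

lemma euler_components: "euler = component 0 euler + component 1 euler + component 2 euler"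
proof (rule fps_ext)
  fix n
  show "euler $ n = (component 0 euler + component 1 euler + component 2 euler) $ n"
    using vanishes_offD[OF vanishes_off_euler, of n] by (auto simp: component_def)
qed

lemma component_1_euler: "component 1 euler = - (fps_X * expand 25 euler)"
proof (rule fps_ext)
  fix n
  show "component 1 euler $ n = (- (fps_X * expand 25 euler)) $ n"
  proof (cases n)
    case (Suc k)
    have "n mod 5 = 1 \<longleftrightarrow> 5 dvd k" "n mod 25 = 1 \<longleftrightarrow> 25 dvd k"
      using Suc by (auto simp: mod_Suc dvd_eq_mod_eq_0)
    moreover have "n div 25 = k div 25" "5 dvd k" if "25 dvd k"
      using Suc that by (auto elim!: dvdE)
    ultimately
    show ?thesis using euler_nth_1_mod_5[of n] Suc by (auto simp: component_def expand_nth)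
  qed (simp add: component_def)
qed

lemma euler_nth_0: "euler $ 0 = 1"
  by (simp add: euler_def)

text \<open>
  Collect the terms of \<open>(A + B + C)\<^sup>3\<close>, where \<open>A\<close>, \<open>B\<close>, \<open>C\<close> are the components of Euler's product, by residue class.
  Those in the class 2 are exactly \<open>3 A (A C + B\<^sup>2)\<close>, and no triangular number is 2 mod 5.
  So this product vanishes, and \<open>A\<close> is cancelled because its constant term is 1.
\<close>
lemma component_relation: "component 0 euler * component 2 euler = - (component 1 euler)\<^sup>2"
proof -
  let ?A = "component 0 euler" and ?B = "component 1 euler" and ?C = "component 2 euler"
  have A: "vanishes_off 0 {0} ?A" and B: "vanishes_off 0 {1} ?B" and C: "vanishes_off 0 {2} ?C"
    by (rule vanishes_off_component)+
  (* Z is the part of the cube in the class 2, and R is the sum of all other terms *)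
  define Z where "Z = 3 * (?A * (?A * ?C + ?B * ?B))"
  have Z: "vanishes_off 0 {2} Z" unfolding Z_def
    by (intro vanishes_off_numeral vanishes_off_mult[OF A, where T = "{2}"] vanishes_off_add
          vanishes_off_mult[OF A C] vanishes_off_mult[OF B B]) auto
  have AA: "vanishes_off 0 {0} (?A * ?A)" and BB: "vanishes_off 0 {2} (?B * ?B)"
    and CC: "vanishes_off 0 {4} (?C * ?C)" and BC: "vanishes_off 0 {3} (?B * ?C)"
    by (rule vanishes_off_mult[OF A A] vanishes_off_mult[OF B B] vanishes_off_mult[OF C C]
          vanishes_off_mult[OF B C]; simp)+
  define R where "R = ?A * ?A * ?A + 3 * (?C * ?C * ?B) + 3 * (?A * ?A * ?B) + ?C * ?C * ?C +
     ?B * ?B * ?B + 6 * (?B * ?C * ?A) + 3 * (?C * ?C * ?A) + 3 * (?B * ?B * ?C)"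
  have R: "vanishes_off 0 {0, 1, 3, 4} R" unfolding R_def
    by (intro vanishes_off_add vanishes_off_numeral vanishes_off_mult[OF AA A] vanishes_off_mult[OF CC B]
          vanishes_off_mult[OF AA B] vanishes_off_mult[OF CC C] vanishes_off_mult[OF BB B]
          vanishes_off_mult[OF BC A] vanishes_off_mult[OF CC A] vanishes_off_mult[OF BB C]) auto
  have "Z = (?A + ?B + ?C) ^ 3 - R"
    unfolding Z_def R_def by (simp add: power3_eq_cube algebra_simps)
  then have "Z = euler ^ 3 - R" by (simp only: euler_components[symmetric])
  moreover have "vanishes_off 0 {0, 1, 3, 4} (euler ^ 3 - R)"
    by (intro vanishes_off_diff R vanishes_off_weaken[OF vanishes_off_euler_cube(1)]) auto
  ultimately have "vanishes_off 0 {0, 1, 3, 4} Z" by simp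
  have "Z = 0"
  proof (rule fps_ext)
    fix n
    show "Z $ n = 0 $ n"
      using vanishes_offD[OF Z, of n] vanishes_offD[OF \<open>vanishes_off 0 {0, 1, 3, 4} Z\<close>, of n] by force
  qed
  moreover have "?A \<noteq> 0"
  proof
    assume "?A = 0"
    then have "?A $ 0 = 0" by simp
    then show False by (simp add: component_def euler_nth_0)
  qed
  ultimately have "?A * ?C + ?B * ?B = 0" by (simp add: Z_def)
  then show ?thesis by (simp add: power2_eq_square eq_neg_iff_add_eq_0)
qed

lemma euler_split:
  obtains R where "vanishes_off 0 {0, 2} R" "euler = R - fps_X * expand 25 euler"
proof
  show "vanishes_off 0 {0, 2} (component 0 euler + component 2 euler)"
    by (intro vanishes_off_add; rule vanishes_off_weaken[OF vanishes_off_component]) auto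
  show "euler = (component 0 euler + component 2 euler) - fps_X * expand 25 euler"
    by (subst (1) euler_components) (simp add: component_1_euler algebra_simps del: One_nat_def)
qed

text \<open>
  The class 2 in the square is \<open>B\<^sup>2 + 2 A C\<close> in terms of the components, and \<open>component_relation\<close> turns this
  into \<open>-B\<^sup>2\<close>, which is explicit.
\<close>
lemma euler_square_split:
  obtains R where "vanishes_off 0 {0, 1, 3, 4} R"
    "euler\<^sup>2 = R - fps_X\<^sup>2 * expand 25 (euler\<^sup>2)"
proof
  let ?A = "component 0 euler" and ?B = "component 1 euler" and ?C = "component 2 euler"
  let ?R = "?A * ?A + 2 * (?A * ?B) + 2 * (?B * ?C) + ?C * ?C"
  have A: "vanishes_off 0 {0} ?A" and B: "vanishes_off 0 {1} ?B" and C: "vanishes_off 0 {2} ?C"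
    by (rule vanishes_off_component)+
  show "vanishes_off 0 {0, 1, 3, 4} ?R"
    by (intro vanishes_off_add vanishes_off_numeral vanishes_off_mult[OF A A] vanishes_off_mult[OF A B]
          vanishes_off_mult[OF B C] vanishes_off_mult[OF C C]) auto
  have "euler\<^sup>2 = (?A + ?B + ?C)\<^sup>2" by (simp only: euler_components[symmetric])
  also have "\<dots> = ?R + ?B\<^sup>2 + 2 * (?A * ?C)" by (simp add: power2_eq_square algebra_simps)
  also have "\<dots> = ?R - ?B\<^sup>2" by (simp add: component_relation)
  also have "?B\<^sup>2 = fps_X\<^sup>2 * expand 25 (euler\<^sup>2)"
    by (simp add: component_1_euler power_mult_distrib expand_power del: One_nat_def)
  finally show "euler\<^sup>2 = ?R - fps_X\<^sup>2 * expand 25 (euler\<^sup>2)" .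
qed

section \<open>The fifth power of Euler's product modulo 5\<close>

lemma qprod_power_5: "ring_cong 5 (qprod q a b ^ 5) (qprod (q ^ 5) a b)"
proof -
  have "ring_cong 5 ((1 - x) ^ 5) (1 - x ^ 5)" for x :: 'a
  proof -
    have "(1 - x) ^ 5 - (1 - x ^ 5) = 5 * (- x + 2 * x ^ 2 - 2 * x ^ 3 + x ^ 4)"
      by (simp add: eval_nat_numeral algebra_simps)
    then show ?thesis unfolding ring_cong_def by (metis dvd_triv_left)
  qed
  then have "ring_cong 5 (\<Prod>i=a..b. (1 - q ^ i) ^ 5) (\<Prod>i=a..b. 1 - (q ^ i) ^ 5)"
    by (intro ring_cong_prod)
  then show ?thesis by (simp add: qprod_def prod_power_distrib mult.commute flip: power_mult)
qed

lemma ring_cong_fpsI: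
  assumes "\<And>n. (numeral m :: int) dvd f $ n - g $ n"
  shows "ring_cong (numeral m) f g"
proof -
  have "f - g = numeral m * Abs_fps (\<lambda>n. (f $ n - g $ n) div numeral m)"
    by (rule fps_ext) (use assms in \<open>simp add: numeral_fps_const\<close>)
  then show ?thesis unfolding ring_cong_def by (metis dvd_triv_left)
qed

lemma euler_power_5: "ring_cong 5 (euler ^ 5) (expand 5 euler)"
proof (rule ring_cong_fpsI)
  fix n
  let ?P = "qprod (fps_X :: int fps) 1 n"
  have 1: "(euler ^ 5) $ n = (?P ^ 5) $ n"
    using ring_cong_power[OF euler_cong[of n n], of 5] by (simp add: ring_cong_X_power_iff del: power_Suc)
  have "euler $ (n div 5) = ?P $ (n div 5)"
    using euler_cong[of n n] by (simp add: ring_cong_X_power_iff del: power_Suc)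
  then have 2: "expand 5 euler $ n = expand 5 ?P $ n"
    by (simp add: expand_nth)
  show "5 dvd (euler ^ 5) $ n - expand 5 euler $ n"
    unfolding 1 2 expand_qprod[OF zero_less_numeral]
    by (rule ring_cong_numeral_fps_nth[OF qprod_power_5])
qed

section \<open>The generating function of coloured partitions\<close>

definition weighted_msets :: "('a \<Rightarrow> nat) \<Rightarrow> 'a set \<Rightarrow> nat \<Rightarrow> 'a multiset set" where
  "weighted_msets w A n = {P. set_mset P \<subseteq> A \<and> (\<Sum>x\<in>#P. w x) = n}"

text \<open>
  A multiset over \<open>insert a A\<close> either avoids \<open>a\<close>, or contains it and loses one copy. On generating functions this
  is multiplication by \<open>1 / (1 - q\<^bsup>w a\<^esup>)\<close> for each new element.
\<close>
lemma weighted_msets_insert: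
  assumes "a \<notin> A"
  shows "weighted_msets w (insert a A) n = weighted_msets w A n \<union>
      (if w a \<le> n then add_mset a ` weighted_msets w (insert a A) (n - w a) else {})"
    (is "?L = ?R")
proof (intro equalityI subsetI)
  fix P assume P: "P \<in> ?L"
  show "P \<in> ?R"
  proof (cases "a \<in># P")
    case True
    then obtain Q where Q: "P = add_mset a Q" by (blast dest: multi_member_split)
    with P have "w a \<le> n" "Q \<in> weighted_msets w (insert a A) (n - w a)"
      by (auto simp: weighted_msets_def)
    with Q show ?thesis by simp
  next
    case False
    with P show ?thesis by (auto simp: weighted_msets_def)
  qed
next
  fix P assume "P \<in> ?R"
  then show "P \<in> ?L" by (auto simp: weighted_msets_def split: if_splits)
qed

text \<open>
  Finiteness is part of the induction because the cardinalities are additive only for finite sets. It needs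
  positive weights, as an element of weight 0 could be repeated arbitrarily often.
\<close>
lemma weighted_msets_gf:
  assumes "finite A" "\<And>a. a \<in> A \<Longrightarrow> w a > 0"
  shows "(\<forall>n. finite (weighted_msets w A n)) \<and>
    Abs_fps (\<lambda>n. int (card (weighted_msets w A n))) * (\<Prod>a\<in>A. 1 - fps_X ^ w a) = 1"
  using assms
proof (induction A)
  case empty
  have *: "weighted_msets w {} n = (if n = 0 then {{#}} else {})" for n
    by (auto simp: weighted_msets_def)
  have "Abs_fps (\<lambda>n. int (card (weighted_msets w {} n))) = 1"
    by (rule fps_ext) (simp add: *)
  then show ?case by (simp add: *)
next
  case (insert a A)
  let ?M = "weighted_msets w (insert a A)" and ?N = "weighted_msets w A"
  have IH: "finite (?N n)" "Abs_fps (\<lambda>n. int (card (?N n))) * (\<Prod>a\<in>A. 1 - fps_X ^ w a) = 1" for n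
    using insert by auto
  have wa: "w a > 0" using insert.prems by simp
  have fin: "finite (?M n)" for n
  proof (induction n rule: less_induct)
    case (less n)
    then show ?case using wa IH(1) by (subst weighted_msets_insert[OF insert.hyps(2)]) auto
  qed
  have "card (?M n) = card (?N n) + (if w a \<le> n then card (?M (n - w a)) else 0)" for n
  proof -
    have "?N n \<subseteq> {P. a \<notin># P}"
      using insert.hyps(2) by (auto simp: weighted_msets_def)
    moreover have "(if w a \<le> n then add_mset a ` ?M (n - w a) else {}) \<subseteq> {P. a \<in># P}"
      by auto
    ultimately have "?N n \<inter> (if w a \<le> n then add_mset a ` ?M (n - w a) else {}) = {}"
      by blast
    moreover have "card (add_mset a ` ?M (n - w a)) = card (?M (n - w a))"
      by (rule card_image) (simp add: inj_on_def)
    ultimately show ?thesis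
      by (subst weighted_msets_insert[OF insert.hyps(2)], subst card_Un_disjoint) (auto simp: fin IH(1))
  qed
  then have "Abs_fps (\<lambda>n. int (card (?M n))) =
      Abs_fps (\<lambda>n. int (card (?N n))) + fps_X ^ w a * Abs_fps (\<lambda>n. int (card (?M n)))"
    by (intro fps_ext) (simp add: fps_X_power_mult_nth)
  then have "Abs_fps (\<lambda>n. int (card (?M n))) * (1 - fps_X ^ w a) = Abs_fps (\<lambda>n. int (card (?N n)))"
    by (simp add: algebra_simps)
  then have "Abs_fps (\<lambda>n. int (card (?M n))) * (\<Prod>a\<in>insert a A. 1 - fps_X ^ w a) = 1"
    using IH(2) insert.hyps by (simp add: mult.assoc[symmetric])
  with fin show ?case by blast
qed

definition partition_gf :: "nat \<Rightarrow> int fps" where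
  "partition_gf r = Abs_fps (\<lambda>n. int (num_colour_partitions r n))"

lemma colour_partitions_eq_weighted_msets:
  assumes "k \<le> n"
  shows "colour_partitions r k = weighted_msets fst ({1..n} \<times> {..<r}) k"
proof (intro equalityI subsetI)
  fix P assume P: "P \<in> colour_partitions r k"
  have "x \<in> {1..n} \<times> {..<r}" if "x \<in># P" for x
  proof -
    obtain Q where "P = add_mset x Q" using multi_member_split[OF \<open>x \<in># P\<close>] by blast
    then have "fst x \<le> k" using P by (auto simp: colour_partitions_def case_prod_unfold)
    then show ?thesis using that P assms
      by (cases x) (force simp: colour_partitions_def)
  qed
  with P show "P \<in> weighted_msets fst ({1..n} \<times> {..<r}) k"
    by (auto simp: weighted_msets_def colour_partitions_def case_prod_unfold)
next
  fix P assume "P \<in> weighted_msets fst ({1..n} \<times> {..<r}) k"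
  then show "P \<in> colour_partitions r k"
    by (force simp: weighted_msets_def colour_partitions_def case_prod_unfold)
qed

theorem partition_gf_times_euler_power: "partition_gf r * euler ^ r = 1"
proof (rule fps_ext)
  fix n :: nat
  let ?A = "{1..n} \<times> {..<r} :: (nat \<times> nat) set"
  let ?G = "Abs_fps (\<lambda>k. int (card (weighted_msets fst ?A k)))"
  have "ring_cong (fps_X ^ Suc n) (partition_gf r) ?G"
    unfolding ring_cong_X_power_iff
    by (auto simp: partition_gf_def num_colour_partitions_def less_Suc_eq_le
          colour_partitions_eq_weighted_msets)
  then have "ring_cong (fps_X ^ Suc n) (partition_gf r * euler ^ r) (?G * qprod fps_X 1 n ^ r)"
    by (intro ring_cong_mult ring_cong_power euler_cong) simp_all
  also have "qprod fps_X 1 n ^ r = (\<Prod>a\<in>?A. 1 - fps_X ^ fst a :: int fps)"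
    by (simp add: qprod_def prod.cartesian_product' prod_power_distrib case_prod_unfold)
  also have "?G * \<dots> = 1"
    by (rule weighted_msets_gf[THEN conjunct2]) auto
  finally show "(partition_gf r * euler ^ r) $ n = 1 $ n"
    unfolding ring_cong_X_power_iff by blast
qed

section \<open>Congruences for coloured partitions\<close>

text \<open>
  This is \<open>E\<^bsup>-(5k+s)\<^esup> = E\<^bsup>-5(k+1)\<^esup> E\<^bsup>5-s\<^esup>\<close> with \<open>E\<^sup>5\<close> replaced by \<open>E(q\<^sup>5)\<close>. The generating functions take the place of
  negative powers.
\<close>

lemma partition_gf_cong:
  assumes "s \<le> 5"
  shows "ring_cong 5 (partition_gf (5 * k + s)) (expand 5 (partition_gf (k + 1)) * euler ^ (5 - s))"
proof -
  let ?P = "partition_gf (5 * k + s)" and ?Q = "partition_gf (k + 1)"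
  have "expand 5 ?Q * expand 5 euler ^ (k + 1) = expand 5 (?Q * euler ^ (k + 1))"
    by (simp add: expand_mult expand_power del: power_Suc)
  also have "\<dots> = 1" by (simp only: partition_gf_times_euler_power fps_compose_1)
  finally have 1: "expand 5 ?Q * expand 5 euler ^ (k + 1) = 1" .
  have "ring_cong 5 (expand 5 ?Q * expand 5 euler ^ (k + 1) * ?P) (expand 5 ?Q * (euler ^ 5) ^ (k + 1) * ?P)"
    by (intro ring_cong_mult ring_cong_power ring_cong_refl ring_cong_sym[OF euler_power_5])
  also have "(euler ^ 5) ^ (k + 1) = euler ^ (5 - s) * euler ^ (5 * k + s)"
    using assms by (simp flip: power_mult power_add)
  also have "expand 5 ?Q * (euler ^ (5 - s) * euler ^ (5 * k + s)) * ?P =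
      expand 5 ?Q * euler ^ (5 - s) * (?P * euler ^ (5 * k + s))"
    by (simp only: mult_ac)
  finally show ?thesis unfolding 1 partition_gf_times_euler_power by simp
qed

lemma vanishes_off_expand_mult:
  assumes "vanishes_off m S f" "S \<subseteq> {..<5}"
  shows "vanishes_off m S (expand 5 g * f)"
proof (rule vanishes_off_mult[OF vanishes_off_expand assms(1)])
  fix s t :: nat assume "s \<in> {0}" "t \<in> S"
  moreover from this assms(2) have "t < 5" by blast
  ultimately show "(s + t) mod 5 \<in> S" by simp
qed simp_all

text \<open>
  In the class \<open>s\<close> mod 5, the product of \<open>H(q\<^sup>5)\<close> with \<open>f\<close> sees only the term \<open>q\<^sup>s K(q\<^bsup>25\<^esup>)\<close> of \<open>f\<close>. Its
  coefficient at \<open>5 (5 n + 4) + s\<close> is, up to sign, the coefficient of \<open>H(q) K(q\<^sup>5)\<close> at \<open>5 n + 4\<close>, which is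
  divisible by \<open>m\<close> because the class 4 is missing in \<open>H\<close>.
\<close>
lemma expand_mult_dissected_nth:
  assumes H: "vanishes_off m {0, 1, 2, 3} H"
    and R: "vanishes_off 0 T R" "T \<subseteq> {..<5}" "s \<notin> T" "s < 5"
    and f: "f = R - fps_X ^ s * expand 25 K"
  shows "m dvd (expand 5 H * f) $ (25 * n + 20 + s)"
proof -
  have "vanishes_off m T (expand 5 H * R)"
    by (intro vanishes_off_expand_mult vanishes_off_weaken[OF R(1)] R(2)) auto
  then have 1: "m dvd (expand 5 H * R) $ (25 * n + 20 + s)"
  proof (rule vanishes_offD)
    have "25 * n + 20 + s = s + 5 * (5 * n + 4)" by simp
    then show "(25 * n + 20 + s) mod 5 \<notin> T"
      using R(3,4) by (simp only: mod_mult_self2 mod_less not_False_eq_True)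
  qed
  have "vanishes_off m {0, 1, 2, 3} (expand 5 K * H)"
    by (rule vanishes_off_expand_mult[OF H]) auto
  then have 2: "m dvd (expand 5 K * H) $ (5 * n + 4)"
    by (rule vanishes_offD) auto
  have "expand 5 H * f = expand 5 H * R - fps_X ^ s * expand 5 (expand 5 K * H)"
    by (simp add: f expand_mult expand_expand algebra_simps)
  moreover have "(fps_X ^ s * expand 5 (expand 5 K * H)) $ (25 * n + 20 + s) = (expand 5 K * H) $ (5 * n + 4)"
    by (simp add: fps_X_power_mult_nth expand_nth)
  ultimately show ?thesis using 1 2 by simp
qed

lemma num_colour_partitions_cong_iff:
  "[num_colour_partitions r n = 0] (mod 5) \<longleftrightarrow> 5 dvd partition_gf r $ n"
  by (simp add: partition_gf_def cong_0_iff) (metis int_dvd_int_iff of_nat_numeral)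

theorem theorem1p1:
  fixes k n :: nat
  shows "[num_colour_partitions (5 * k + 1) (5 * n + 4) = 0] (mod 5) \<and>
         (\<forall>i \<in> {2, 3, 4}. [num_colour_partitions (5 * k + 2) (5 * n + i) = 0] (mod 5)) \<and>
         (\<forall>i \<in> {3, 4}. [num_colour_partitions (5 * k + 4) (5 * n + i) = 0] (mod 5)) \<and>
         [num_colour_partitions (25 * k + 3) (25 * n + 22) = 0] (mod 5) \<and>
         [num_colour_partitions (25 * k + 4) (25 * n + 21) = 0] (mod 5)"
proof -
  have E1: "vanishes_off 5 {0, 1, 2} euler"
    by (rule vanishes_off_weaken[OF vanishes_off_euler]) simp
  have "vanishes_off 5 {0, 1, 2, 3} (euler ^ 3 * euler)"
    by (rule vanishes_off_mult[OF vanishes_off_euler_cube(2) E1]) auto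
  then have E4: "vanishes_off 5 {0, 1, 2, 3} (euler ^ 4)"
    by (simp add: eval_nat_numeral mult_ac)
  have P1: "vanishes_off 5 {0, 1, 2, 3} (partition_gf (5 * k + 1))" for k
    using vanishes_off_cong[OF partition_gf_cong[of 1 k] vanishes_off_expand_mult] E4 by simp
  have P2: "vanishes_off 5 {0, 1} (partition_gf (5 * k + 2))"
    using vanishes_off_cong[OF partition_gf_cong[of 2 k] vanishes_off_expand_mult]
      vanishes_off_euler_cube(2) by simp
  have P4: "vanishes_off 5 {0, 1, 2} (partition_gf (5 * k + 4))"
    using vanishes_off_cong[OF partition_gf_cong[of 4 k] vanishes_off_expand_mult] E1 by simp
  (* in 25 k + s = 5 k' + s with k' = 5 k, the series in q^5 comes from k' + 1 = 5 k + 1 colours, the case P1 *)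
  have transfer: "5 dvd partition_gf (25 * k + s) $ j"
    if "s \<le> 5" "5 dvd (expand 5 (partition_gf (5 * k + 1)) * euler ^ (5 - s)) $ j" for s j
    using ring_cong_numeral_fps_nth[OF partition_gf_cong[of s "5 * k"], of j] that
    by (simp add: dvd_diff_right_iff) (metis dvd_add diff_add_cancel)
  have "5 dvd partition_gf (25 * k + 3) $ (25 * n + 20 + 2)"
  proof (rule transfer)
    show "5 dvd (expand 5 (partition_gf (5 * k + 1)) * euler ^ (5 - 3)) $ (25 * n + 20 + 2)"
      by (rule euler_square_split, rule expand_mult_dissected_nth[OF P1]) auto
  qed simp
  moreover have "5 dvd partition_gf (25 * k + 4) $ (25 * n + 20 + 1)"
  proof (rule transfer)
    show "5 dvd (expand 5 (partition_gf (5 * k + 1)) * euler ^ (5 - 4)) $ (25 * n + 20 + 1)"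
      by (rule euler_split, rule expand_mult_dissected_nth[OF P1]) auto
  qed simp
  moreover have "5 dvd partition_gf (5 * k + 1) $ (5 * n + 4)"
    by (rule vanishes_offD[OF P1]) auto
  moreover have "5 dvd partition_gf (5 * k + 2) $ (5 * n + i)" if "i \<in> {2, 3, 4}" for i
    by (rule vanishes_offD[OF P2]) (use that in auto)
  moreover have "5 dvd partition_gf (5 * k + 4) $ (5 * n + i)" if "i \<in> {3, 4}" for i
    by (rule vanishes_offD[OF P4]) (use that in auto)
  ultimately show ?thesis unfolding num_colour_partitions_cong_iff by (auto simp: add.commute)
qed

end
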